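(* For every integer $k\ge 0$, the neighborhood complex $\mathcal{N}(S_{3,k})$ collapses (by a finite sequence of elementary simplicial collapses) onto the neighborhood complex $\mathcal{N}(SG_{3,k})$.
   Context: For a positive integer $n$, $[n]=\{1,\dots,n\}$. Fix an integer $k\ge 0$; arithmetic on elements of $[k+6]$ is modulo $k+6$ with representatives in $[k+6]$. The Kneser graph $KG_{3,k}$ has as vertices the $3$-element subsets of $[k+6]$, two vertices being adjacent iff they are disjoint. A vertex $v$ is stable if there is no $t\in[k+6]$ with $\{t,t+1\}\subseteq v$ (addition mod $k+6$, so $\{k+6,1\}$ counts as such a pair), and unstable otherwise. $SG_{3,k}$ (the stable Kneser graph) is the induced subgraph of $KG_{3,k}$ on the stable vertices. $S_{3,k}$ is the graph with the same vertex set as $KG_{3,k}$ whose edges are those edges of $KG_{3,k}$ having at least one stable endpoint. For a graph $G$, the neighborhood complex $\mathcal{N}(G)$ is the simplicial complex whose vertices are the non-isolated vertices of $G$ and whose simplices are the nonempty sets of vertices having a common neighbor in $G$. An elementary collapse removes from a simplicial complex all simplices $\gamma$ with $\sigma\subseteq\gamma\subseteq\tau$, where $\sigma\subsetneq\tau$ and $\tau$ is the unique maximal simplex containing $\sigma$. *)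

theory Defs
  imports Main
begin

text \<open>Finite simple graphs: an edge is the two-element set of its endpoints.\<close>

record 'a graph =
  verts :: "'a set"
  edges :: "'a set set"

definition adjacent :: "'a graph \<Rightarrow> 'a \<Rightarrow> 'a \<Rightarrow> bool" where
  "adjacent G u v \<longleftrightarrow> {u, v} \<in> edges G"

definition induced_subgraph :: "'a graph \<Rightarrow> 'a set \<Rightarrow> 'a graph" where
  "induced_subgraph G W = \<lparr>verts = verts G \<inter> W, edges = {e \<in> edges G. e \<subseteq> W}\<rparr>"

definition kneser_verts :: "nat \<Rightarrow> nat set set" where
  "kneser_verts k = {v. v \<subseteq> {1..k+6} \<and> card v = 3}"

definition KG3 :: "nat \<Rightarrow> nat set graph" where
  "KG3 k = \<lparr>verts = kneser_verts k,
            edges = {{u, v} | u v. u \<in> kneser_verts k \<and> v \<in> kneser_verts k \<and> u \<inter> v = {}}\<rparr>"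

text \<open>With representatives in \<open>{1..m}\<close>, the successor of \<open>t\<close> modulo \<open>m\<close> is \<open>t mod m + 1\<close>;
  in particular the successor of \<open>m\<close> is \<open>1\<close>.\<close>

definition stable :: "nat \<Rightarrow> nat set \<Rightarrow> bool" where
  "stable k v \<longleftrightarrow> \<not> (\<exists>t \<in> {1..k+6}. {t, t mod (k+6) + 1} \<subseteq> v)"

definition SG3 :: "nat \<Rightarrow> nat set graph" where
  "SG3 k = induced_subgraph (KG3 k) {v \<in> verts (KG3 k). stable k v}"

definition S3 :: "nat \<Rightarrow> nat set graph" where
  "S3 k = \<lparr>verts = verts (KG3 k), edges = {e \<in> edges (KG3 k). \<exists>v \<in> e. stable k v}\<rparr>"

text \<open>A simplicial complex is represented by the set of its (nonempty, finite) simplices; its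
  vertices are the \<open>v\<close> for which \<open>{v}\<close> is a simplex.  Below, these are exactly the non-isolated
  vertices of the graph.\<close>

definition neighborhood_complex :: "'a graph \<Rightarrow> 'a set set" where
  "neighborhood_complex G =
     {A. A \<noteq> {} \<and> finite A \<and> A \<subseteq> verts G \<and> (\<exists>w \<in> verts G. \<forall>a \<in> A. adjacent G a w)}"

definition maximal_simplex :: "'a set set \<Rightarrow> 'a set \<Rightarrow> bool" where
  "maximal_simplex X \<tau> \<longleftrightarrow> \<tau> \<in> X \<and> (\<forall>\<rho> \<in> X. \<tau> \<subseteq> \<rho> \<longrightarrow> \<rho> = \<tau>)"

definition elementary_collapse :: "'a set set \<Rightarrow> 'a set set \<Rightarrow> bool" where
  "elementary_collapse X Y \<longleftrightarrow>
     (\<exists>\<sigma> \<tau>. \<sigma> \<in> X \<and> \<sigma> \<subset> \<tau> \<and> maximal_simplex X \<tau>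
        \<and> (\<forall>\<rho>. maximal_simplex X \<rho> \<and> \<sigma> \<subseteq> \<rho> \<longrightarrow> \<rho> = \<tau>)
        \<and> Y = X - {\<gamma>. \<sigma> \<subseteq> \<gamma> \<and> \<gamma> \<subseteq> \<tau>})"

definition collapses_onto :: "'a set set \<Rightarrow> 'a set set \<Rightarrow> bool" where
  "collapses_onto = elementary_collapse\<^sup>*\<^sup>*"

end

theory Submission
  imports Defs "HOL-Library.Product_Lexorder"
begin

text \<open>Both steps are acyclic matchings that toggle one vertex of a simplex \<open>A\<close>.

  First the simplices with an unstable vertex \<open>{r, r + 1, t}\<close> are removed.  Reading the cycle from
  \<open>r\<close>, let \<open>p < q < s\<close> be the greedy stable triple in the complement of \<open>\<Union>A\<close>.  It does not change
  when \<open>p + 1\<close> or \<open>q + 1\<close> becomes covered or uncovered, so a stable vertex consisting of one of these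
  two points, \<open>t\<close>, and one of \<open>r\<close>, \<open>r + 1\<close> can be toggled.

  Then the simplices \<open>A\<close> of stable vertices are removed for which the complement of \<open>\<Union>A\<close> contains a
  triple but no stable one.  Here the toggled vertex arises from the lexicographically largest
  member of \<open>A\<close> by an exchange of one element that leaves \<open>\<Union>A\<close> unchanged; this is the linear quotient
  property of the ideal of stable triples.\<close>

section \<open>Collapsing along a toggle\<close>

text \<open>A maximal simplex over \<open>\<tau> - {x}\<close> contains \<open>x\<close>, as
  otherwise \<open>uniq\<close> would enlarge it; so it lies above \<open>\<tau>\<close> and equals
  it. The removed interval then has just two members.\<close>

lemma elementary_collapse_pair:
  assumes "\<tau> \<in> X" and "\<tau> - {x} \<in> X" and "x \<in> \<tau>"
    and max: "\<And>\<rho>. \<rho> \<in> X \<Longrightarrow> \<tau> \<subseteq> \<rho> \<Longrightarrow> \<rho> = \<tau>"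
    and uniq: "\<And>\<rho>. \<rho> \<in> X \<Longrightarrow> \<tau> - {x} \<subseteq> \<rho> \<Longrightarrow> x \<notin> \<rho> \<Longrightarrow> insert x \<rho> \<in> X"
  shows "elementary_collapse X (X - {\<tau> - {x}, \<tau>})"
proof -
  have mt: "maximal_simplex X \<tau>"
    using assms(1) max by (auto simp: maximal_simplex_def)
  have u: "\<rho> = \<tau>" if "maximal_simplex X \<rho>" "\<tau> - {x} \<subseteq> \<rho>" for \<rho>
  proof -
    have r: "\<rho> \<in> X" and rm: "\<And>\<rho>'. \<rho>' \<in> X \<Longrightarrow> \<rho> \<subseteq> \<rho>' \<Longrightarrow> \<rho>' = \<rho>"
      using that(1) by (auto simp: maximal_simplex_def)
    have "x \<in> \<rho>"
      using uniq[OF r that(2)] rm[of "insert x \<rho>"] by blast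
    then show ?thesis using max[OF r] that(2) by blast
  qed
  have "X - {\<tau> - {x}, \<tau>} = X - {\<gamma>. \<tau> - {x} \<subseteq> \<gamma> \<and> \<gamma> \<subseteq> \<tau>}"
    using assms(3) by auto
  moreover have "\<tau> - {x} \<subset> \<tau>" using assms(3) by auto
  moreover have "\<forall>\<rho>. maximal_simplex X \<rho> \<and> \<tau> - {x} \<subseteq> \<rho> \<longrightarrow> \<rho> = \<tau>" using u by simp
  ultimately show ?thesis
    unfolding elementary_collapse_def using assms(2) mt by (intro exI conjI)
qed

text \<open>A perfect matching \<open>A \<leftrightarrow> A \<triangle> {g A}\<close> is acyclic as soon as \<open>g\<close> is constant along inclusions within
  the fibres of a monotone statistic \<open>h\<close>.\<close>

lemma collapses_onto_toggle:
  fixes h :: "'a set \<Rightarrow> 'b::linorder"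
  assumes "finite X" and "Y \<subseteq> X" and "\<And>A. A \<in> X \<Longrightarrow> finite A"
    and up: "\<And>A B. A \<in> X - Y \<Longrightarrow> B \<in> X \<Longrightarrow> A \<subseteq> B \<Longrightarrow> B \<notin> Y"
    and ins: "\<And>A. A \<in> X - Y \<Longrightarrow> insert (g A) A \<in> X - Y \<and> h (insert (g A) A) = h A"
    and rem: "\<And>A. A \<in> X - Y \<Longrightarrow> A - {g A} \<in> X - Y \<and> h (A - {g A}) = h A"
    and mono: "\<And>A B. A \<in> X - Y \<Longrightarrow> B \<in> X - Y \<Longrightarrow> A \<subseteq> B \<Longrightarrow> h A \<le> h B"
    and fib: "\<And>A B. A \<in> X - Y \<Longrightarrow> B \<in> X - Y \<Longrightarrow> A \<subseteq> B \<Longrightarrow> h A = h B \<Longrightarrow> g A = g B"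
  shows "collapses_onto X Y"
  using assms
proof (induction "card (X - Y)" arbitrary: X rule: less_induct)
  case (less X)
  note up = less.prems(4) and ins = less.prems(5) and rem = less.prems(6)
    and mono = less.prems(7) and fib = less.prems(8)
  show ?case
  proof (cases "X = Y")
    case True
    then show ?thesis by (simp add: collapses_onto_def)
  next
    case False
    then have ne: "X - Y \<noteq> {}" and fin: "finite (X - Y)" using less.prems(1,2) by auto
    \<comment> \<open>Take the largest value of \<open>h\<close> and, within that fibre, the largest
      cardinality. By \<open>mono\<close> such a simplex has no proper coface, and every coface of
      its partner lies in the same fibre.\<close>
    let ?M = "(\<lambda>A. (h A, card A)) ` (X - Y)"
    have "Max ?M \<in> ?M" using ne fin by (intro Max_in) blast+
    then obtain \<tau> where \<tau>: "\<tau> \<in> X - Y" and "Max ?M = (h \<tau>, card \<tau>)"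
      by (rule imageE) (rule that)
    then have "(h A, card A) \<le> (h \<tau>, card \<tau>)" if "A \<in> X - Y" for A
      using Max_ge[OF finite_imageI[OF fin] imageI[OF that]] by metis
    then have top: "h A < h \<tau> \<or> h A = h \<tau> \<and> card A \<le> card \<tau>" if "A \<in> X - Y" for A
      using that by (fastforce simp: less_eq_prod_def)
    define x where "x = g \<tau>"
    have max: "\<rho> = \<tau>" if "\<rho> \<in> X" "\<tau> \<subseteq> \<rho>" for \<rho>
    proof -
      have r: "\<rho> \<in> X - Y" using up[OF \<tau> that] that(1) by simp
      have "card \<rho> \<le> card \<tau>" using mono[OF \<tau> r that(2)] top[OF r] by (meson leD)
      then show ?thesis
        by (rule card_seteq[OF less.prems(3)[OF that(1)] that(2), symmetric])
    qed
    have x\<tau>: "x \<in> \<tau>"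
      using max[of "insert x \<tau>"] ins[OF \<tau>] by (auto simp: x_def)
    have \<sigma>: "\<tau> - {x} \<in> X - Y" and h\<sigma>: "h (\<tau> - {x}) = h \<tau>"
      using rem[OF \<tau>] by (auto simp: x_def)
    have g\<sigma>: "g (\<tau> - {x}) = x"
      using fib[OF \<sigma> \<tau> _ h\<sigma>] by (auto simp: x_def)
    have "insert x \<rho> \<in> X" if "\<rho> \<in> X" "\<tau> - {x} \<subseteq> \<rho>" for \<rho>
    proof -
      have r: "\<rho> \<in> X - Y" using up[OF \<sigma> that] that(1) by simp
      have "h (\<tau> - {x}) = h \<rho>"
        using mono[OF \<sigma> r that(2)] top[OF r] h\<sigma> by (metis leD)
      then have "g \<rho> = x" using fib[OF \<sigma> r that(2)] g\<sigma> by simp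
      then show ?thesis using ins[OF r] by simp
    qed
    then have step: "elementary_collapse X (X - {\<tau> - {x}, \<tau>})"
      using elementary_collapse_pair[of \<tau> X x] \<tau> \<sigma> x\<tau> max by blast
    define X' where "X' = X - {\<tau> - {x}, \<tau>}"
    have sub: "X' - Y \<subseteq> X - Y" by (auto simp: X'_def)
    \<comment> \<open>The toggle preserves \<open>g\<close>, so if it led to one of the two removed
      simplices, \<open>g A\<close> would be \<open>x\<close>; toggling \<open>x\<close> only
      exchanges these two, and \<open>A\<close> is neither.\<close>
    have closed: "insert (g A) A \<in> X' - Y \<and> A - {g A} \<in> X' - Y" if A: "A \<in> X' - Y" for A
    proof -
      have AX: "A \<in> X - Y" and An: "A \<noteq> \<tau> - {x}" "A \<noteq> \<tau>" using A by (auto simp: X'_def)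
      have i: "insert (g A) A \<in> X - Y" "g (insert (g A) A) = g A"
        using ins[OF AX] fib[OF AX _ subset_insertI, of "g A"] by metis+
      have d: "A - {g A} \<in> X - Y" "g (A - {g A}) = g A"
        using rem[OF AX] fib[OF _ AX Diff_subset, of "{g A}"] by metis+
      have "insert (g A) A \<noteq> \<tau>"
      proof
        assume e: "insert (g A) A = \<tau>"
        then have "g A = x" using i(2) by (simp add: x_def)
        then show False using e An by blast
      qed
      moreover have "insert (g A) A \<noteq> \<tau> - {x}"
      proof
        assume e: "insert (g A) A = \<tau> - {x}"
        then have "g A = x" using i(2) g\<sigma> by simp
        then show False using e by blast
      qed
      moreover have "A - {g A} \<noteq> \<tau>"
      proof
        assume e: "A - {g A} = \<tau>"
        then have "g A = x" using d(2) by (simp add: x_def)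
        then show False using e x\<tau> by blast
      qed
      moreover have "A - {g A} \<noteq> \<tau> - {x}"
      proof
        assume e: "A - {g A} = \<tau> - {x}"
        then have "g A = x" using d(2) g\<sigma> by simp
        then show False using e An x\<tau> by blast
      qed
      ultimately show ?thesis using i(1) d(1) by (simp add: X'_def)
    qed
    have lt: "card (X' - Y) < card (X - Y)"
      by (rule psubset_card_mono[OF fin]) (use \<tau> in \<open>auto simp: X'_def\<close>)
    have "collapses_onto X' Y"
    proof (rule less.hyps[OF lt])
      show "finite X'" using less.prems(1) by (simp add: X'_def)
      show "Y \<subseteq> X'" using less.prems(2) \<tau> \<sigma> by (auto simp: X'_def)
      show "finite A" if "A \<in> X'" for A using that less.prems(3) by (auto simp: X'_def)
      show "B \<notin> Y" if "A \<in> X' - Y" "B \<in> X'" "A \<subseteq> B" for A B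
        using up[of A B] that by (auto simp: X'_def)
      show "insert (g A) A \<in> X' - Y \<and> h (insert (g A) A) = h A" if "A \<in> X' - Y" for A
        using closed[OF that] ins that sub by blast
      show "A - {g A} \<in> X' - Y \<and> h (A - {g A}) = h A" if "A \<in> X' - Y" for A
        using closed[OF that] rem that sub by blast
      show "h A \<le> h B" if "A \<in> X' - Y" "B \<in> X' - Y" "A \<subseteq> B" for A B
        using mono that sub by blast
      show "g A = g B" if "A \<in> X' - Y" "B \<in> X' - Y" "A \<subseteq> B" "h A = h B" for A B
        using fib that sub by blast
    qed
    with step show ?thesis
      unfolding collapses_onto_def X'_def by (rule converse_rtranclp_into_rtranclp)
  qed
qed

section \<open>Rotated coordinates on the cycle\<close>

text \<open>The point \<open>j\<close> steps after \<open>r\<close> on the cycle; meant for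
  \<open>j < k + 6\<close>, where one subtraction is enough.\<close>

definition rot :: "nat \<Rightarrow> nat \<Rightarrow> nat \<Rightarrow> nat" where
  "rot k r j = (if r + j \<le> k + 6 then r + j else r + j - (k + 6))"

lemma rot_0: "r \<in> {1..k+6} \<Longrightarrow> rot k r 0 = r"
  by (simp add: rot_def)

lemma rot_1: "r \<in> {1..k+6} \<Longrightarrow> rot k r 1 = r mod (k+6) + 1"
  by (cases "r = k + 6") (auto simp: rot_def)

lemma rot_in: "r \<in> {1..k+6} \<Longrightarrow> j < k + 6 \<Longrightarrow> rot k r j \<in> {1..k+6}"
  by (auto simp: rot_def)

lemma rot_eq_iff: "r \<in> {1..k+6} \<Longrightarrow> i < k + 6 \<Longrightarrow> j < k + 6 \<Longrightarrow> rot k r i = rot k r j \<longleftrightarrow> i = j"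
  by (auto simp: rot_def split: if_splits)

lemma inj_on_rot: "r \<in> {1..k+6} \<Longrightarrow> P \<subseteq> {..<k+6} \<Longrightarrow> inj_on (rot k r) P"
  by (rule inj_onI) (metis rot_eq_iff lessThan_iff subsetD)

lemma rot_surj:
  assumes "r \<in> {1..k+6}" "t \<in> {1..k+6}"
  obtains j where "j < k + 6" "t = rot k r j"
proof
  show "(if r \<le> t then t - r else t + (k + 6) - r) < k + 6"
    "t = rot k r (if r \<le> t then t - r else t + (k + 6) - r)"
    using assms by (auto simp: rot_def)
qed

lemma rot_Suc:
  assumes "r \<in> {1..k+6}" "j < k + 6"
  shows "rot k r j mod (k+6) + 1 = rot k r (if j = k + 5 then 0 else Suc j)"
proof (cases "rot k r j = k + 6")
  case True
  then have "rot k r j mod (k+6) + 1 = 1" by simp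
  then show ?thesis using True assms by (auto simp: rot_def split: if_splits)
next
  case False
  then have "rot k r j mod (k+6) + 1 = rot k r j + 1" using rot_in[OF assms] by auto
  then show ?thesis using False assms by (auto simp: rot_def split: if_splits)
qed

lemma rot_mem_image_iff:
  assumes "r \<in> {1..k+6}" "P \<subseteq> {..<k+6}" "j < k + 6"
  shows "rot k r j \<in> rot k r ` P \<longleftrightarrow> j \<in> P"
  using assms rot_eq_iff[OF assms(1,3)] by (auto simp: subset_iff)

text \<open>Rotation preserves cyclic successors. \<open>Suc\<close> misses only the step from
  \<open>k + 5\<close> back to \<open>0\<close>, hence the extra condition.\<close>

lemma stable_rot_iff:
  assumes r: "r \<in> {1..k+6}" and P: "P \<subseteq> {..<k+6}"
  shows "stable k (rot k r ` P) \<longleftrightarrow> (\<forall>j\<in>P. Suc j \<notin> P) \<and> \<not> (0 \<in> P \<and> k + 5 \<in> P)"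
proof -
  have "stable k (rot k r ` P) \<longleftrightarrow>
      \<not> (\<exists>j<k+6. j \<in> P \<and> (if j = k + 5 then 0 else Suc j) \<in> P)"
  proof -
    have *: "{rot k r j, rot k r j mod (k+6) + 1} \<subseteq> rot k r ` P \<longleftrightarrow>
        j \<in> P \<and> (if j = k + 5 then 0 else Suc j) \<in> P" if "j < k + 6" for j
      using rot_mem_image_iff[OF r P that] rot_Suc[OF r that]
        rot_mem_image_iff[OF r P, of "if j = k + 5 then 0 else Suc j"] that by auto
    have "{1..k+6} = rot k r ` {..<k+6}"
      using rot_in[OF r] rot_surj[OF r] by blast
    then show ?thesis
      unfolding stable_def using * by auto
  qed
  also have "\<dots> \<longleftrightarrow> (\<forall>j\<in>P. Suc j \<notin> P) \<and> \<not> (0 \<in> P \<and> k + 5 \<in> P)"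
  proof -
    let ?s = "\<lambda>j. if j = k + 5 then 0 else Suc j"
    have lt: "j < k + 6" if "j \<in> P" for j using P that by auto
    have "(\<exists>j<k+6. j \<in> P \<and> ?s j \<in> P) \<longleftrightarrow> (\<exists>j\<in>P. Suc j \<in> P) \<or> 0 \<in> P \<and> k + 5 \<in> P" (is "?L \<longleftrightarrow> ?R")
    proof
      assume ?L
      then obtain j where j: "j \<in> P" "?s j \<in> P" by blast
      then show ?R by (cases "j = k + 5") auto
    next
      assume ?R
      then show ?L
      proof
        assume "\<exists>j\<in>P. Suc j \<in> P"
        then obtain j where j: "j \<in> P" "Suc j \<in> P" by blast
        then have "?s j \<in> P" using lt[of "Suc j"] by simp
        then show ?L using j lt by blast
      next
        assume "0 \<in> P \<and> k + 5 \<in> P"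
        then show ?L by (intro exI[of _ "k + 5"]) simp
      qed
    qed
    then show ?thesis by blast
  qed
  finally show ?thesis .
qed

lemma rot_image_kneser:
  assumes "r \<in> {1..k+6}" "P \<subseteq> {..<k+6}" "card P = 3"
  shows "rot k r ` P \<in> kneser_verts k"
proof -
  have "rot k r ` P \<subseteq> {1..k+6}"
    using rot_in[OF assms(1)] assms(2) by (intro image_subsetI) blast
  then show ?thesis
    using card_image[OF inj_on_rot[OF assms(1,2)]] assms(3) by (simp add: kneser_verts_def)
qed

lemma kneser_rot:
  assumes r: "r \<in> {1..k+6}" and v: "v \<in> kneser_verts k"
  obtains P where "P \<subseteq> {..<k+6}" "card P = 3" "v = rot k r ` P"
proof
  let ?P = "{j. j < k + 6 \<and> rot k r j \<in> v}"
  show P: "?P \<subseteq> {..<k+6}" by auto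
  show v': "v = rot k r ` ?P"
  proof
    show "v \<subseteq> rot k r ` ?P"
    proof
      fix t assume "t \<in> v"
      moreover from this v have "t \<in> {1..k+6}" by (auto simp: kneser_verts_def)
      ultimately show "t \<in> rot k r ` ?P" using rot_surj[OF r, of t] by blast
    qed
  qed auto
  show "card ?P = 3"
    using card_image[OF inj_on_rot[OF r P]] v v' by (simp add: kneser_verts_def)
qed

section \<open>Vertices as increasing triples of positions\<close>

lemma sorted_triple:
  assumes "card (P :: nat set) = 3"
  obtains a b c where "a < b" "b < c" "P = {a, b, c}"
proof -
  obtain x y z where P: "P = {x, y, z}" and "x \<noteq> y" "x \<noteq> z" "y \<noteq> z"
    using assms by (auto simp: card_3_iff)
  then consider "x < y" "y < z" | "x < z" "z < y" | "y < x" "x < z" | "y < z" "z < x"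
    | "z < x" "x < y" | "z < y" "y < x" by linarith
  then show thesis
  proof cases
    case 1 then show thesis using that[of x y z] P by blast
  next
    case 2 then show thesis using that[of x z y] P by blast
  next
    case 3 then show thesis using that[of y x z] P by blast
  next
    case 4 then show thesis using that[of y z x] P by blast
  next
    case 5 then show thesis using that[of z x y] P by blast
  next
    case 6 then show thesis using that[of z y x] P by blast
  qed
qed

lemma finite_kneser_verts: "finite (kneser_verts k)"
  by (rule finite_subset[of _ "Pow {1..k+6}"]) (auto simp: kneser_verts_def)

lemma kneser_rot_sorted:
  assumes "r \<in> {1..k+6}" "v \<in> kneser_verts k"
  obtains a b c where "a < b" "b < c" "c < k + 6" "v = rot k r ` {a, b, c}"
proof -
  obtain P where P: "P \<subseteq> {..<k+6}" "card P = 3" "v = rot k r ` P"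
    using kneser_rot[OF assms] .
  obtain a b c where "a < b" "b < c" "P = {a, b, c}"
    using sorted_triple[OF P(2)] .
  then show thesis using that[of a b c] P by auto
qed

lemma rot_triple_kneser:
  assumes "r \<in> {1..k+6}" "a < b" "b < c" "c < k + 6"
  shows "rot k r ` {a, b, c} \<in> kneser_verts k"
  by (rule rot_image_kneser[OF assms(1)]) (use assms in \<open>auto simp: card_insert_if\<close>)

lemma stable_rot_triple_iff:
  assumes "r \<in> {1..k+6}" "a < b" "b < c" "c < k + 6"
  shows "stable k (rot k r ` {a, b, c}) \<longleftrightarrow> a + 2 \<le> b \<and> b + 2 \<le> c \<and> \<not> (a = 0 \<and> c = k + 5)"
proof -
  have "{a, b, c} \<subseteq> {..<k+6}" using assms by auto
  from stable_rot_iff[OF assms(1) this] show ?thesis using assms(2-4) by auto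
qed

lemma rot_mem_triple_iff:
  assumes "r \<in> {1..k+6}" "a < b" "b < c" "c < k + 6" "j < k + 6"
  shows "rot k r j \<in> rot k r ` {a, b, c} \<longleftrightarrow> j = a \<or> j = b \<or> j = c"
  using rot_mem_image_iff[of r k "{a, b, c}" j] assms by auto

lemma rot_triple_inject:
  assumes "r \<in> {1..k+6}" "a < b" "b < c" "c < k + 6" "a' < b'" "b' < c'" "c' < k + 6"
    and eq: "rot k r ` {a, b, c} = rot k r ` {a', b', c'}"
  shows "a = a' \<and> b = b' \<and> c = c'"
proof -
  have "j = a \<or> j = b \<or> j = c \<longleftrightarrow> j = a' \<or> j = b' \<or> j = c'" if "j < k + 6" for j
    using rot_mem_triple_iff[OF assms(1-4) that] rot_mem_triple_iff[OF assms(1,5-7) that]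
    unfolding eq by blast
  from this[of a] this[of b] this[of c] this[of a'] this[of b'] this[of c']
  show ?thesis using assms(2-7) by auto
qed

section \<open>Membership in the neighborhood complexes\<close>

lemma adjacent_KG3: "adjacent (KG3 k) u v \<longleftrightarrow> u \<in> kneser_verts k \<and> v \<in> kneser_verts k \<and> u \<inter> v = {}"
  unfolding adjacent_def KG3_def by (auto simp: doubleton_eq_iff)

lemma adjacent_S3:
  "adjacent (S3 k) u v \<longleftrightarrow> adjacent (KG3 k) u v \<and> (stable k u \<or> stable k v)"
  unfolding adjacent_def S3_def by auto

lemma adjacent_SG3:
  "adjacent (SG3 k) u v \<longleftrightarrow> adjacent (KG3 k) u v \<and> stable k u \<and> stable k v"
proof -
  have "u \<in> verts (KG3 k) \<and> v \<in> verts (KG3 k)" if "adjacent (KG3 k) u v"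
    using that by (simp add: adjacent_KG3) (simp add: KG3_def)
  then show ?thesis
    unfolding SG3_def induced_subgraph_def adjacent_def by auto
qed

text \<open>Every edge needs a stable endpoint, so unless the common neighbor is itself stable, all
  members must be.\<close>

lemma in_neighborhood_S3_iff:
  "A \<in> neighborhood_complex (S3 k) \<longleftrightarrow> A \<noteq> {} \<and> A \<subseteq> kneser_verts k \<and>
     (\<exists>w\<in>kneser_verts k. w \<inter> \<Union>A = {} \<and> ((\<forall>a\<in>A. stable k a) \<or> stable k w))"
proof -
  have "verts (S3 k) = kneser_verts k" by (simp add: S3_def KG3_def)
  moreover have "finite A" if "A \<subseteq> kneser_verts k"
    using finite_subset[OF that finite_kneser_verts] .
  moreover have "(\<forall>a\<in>A. adjacent (S3 k) a w) \<longleftrightarrow>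
      w \<inter> \<Union>A = {} \<and> ((\<forall>a\<in>A. stable k a) \<or> stable k w)"
    if "A \<subseteq> kneser_verts k" "w \<in> kneser_verts k" for w
    unfolding adjacent_S3 adjacent_KG3 using that by blast
  ultimately show ?thesis
    unfolding neighborhood_complex_def mem_Collect_eq by (metis (no_types, lifting))
qed

lemma in_neighborhood_SG3_iff:
  "A \<in> neighborhood_complex (SG3 k) \<longleftrightarrow> A \<noteq> {} \<and> A \<subseteq> kneser_verts k \<and> (\<forall>a\<in>A. stable k a) \<and>
     (\<exists>w\<in>kneser_verts k. w \<inter> \<Union>A = {} \<and> stable k w)"
proof -
  have "verts (SG3 k) = {v \<in> kneser_verts k. stable k v}"
    by (auto simp: SG3_def induced_subgraph_def KG3_def)
  moreover have "finite A" if "A \<subseteq> kneser_verts k"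
    using finite_subset[OF that finite_kneser_verts] .
  moreover have "(\<forall>a\<in>A. adjacent (SG3 k) a w) \<longleftrightarrow> w \<inter> \<Union>A = {}"
    if "A \<subseteq> {v \<in> kneser_verts k. stable k v}" "w \<in> {v \<in> kneser_verts k. stable k v}" for w
    unfolding adjacent_SG3 adjacent_KG3 using that by blast
  moreover have "A \<subseteq> {v \<in> kneser_verts k. stable k v} \<longleftrightarrow> A \<subseteq> kneser_verts k \<and> (\<forall>a\<in>A. stable k a)"
    by blast
  ultimately show ?thesis
    unfolding neighborhood_complex_def mem_Collect_eq by auto
qed

lemma finite_neighborhood_S3: "finite (neighborhood_complex (S3 k))"
  by (rule finite_subset[of _ "Pow (kneser_verts k)"])
    (auto simp: in_neighborhood_S3_iff finite_kneser_verts)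

section \<open>Removing the unstable vertices\<close>

text \<open>The first two entries of the greedy stable triple, on the line rather than the cycle.
  The second minimum is meaningful only if \<open>G\<close> has two elements at distance at least
  2.\<close>

definition firsts :: "nat set \<Rightarrow> nat \<times> nat" where
  "firsts G = (Min G, Min {j \<in> G. Min G + 2 \<le> j})"

lemma firsts_eqI:
  assumes "finite G" "p \<in> G" "q \<in> G" "p + 2 \<le> q"
    and "\<And>j. j \<in> G \<Longrightarrow> p \<le> j" and "\<And>j. j \<in> G \<Longrightarrow> p + 2 \<le> j \<Longrightarrow> q \<le> j"
  shows "firsts G = (p, q)"
proof -
  have "Min G = p" using assms by (intro Min_eqI) auto
  moreover have "Min {j \<in> G. p + 2 \<le> j} = q" using assms by (intro Min_eqI) auto
  ultimately show ?thesis by (simp add: firsts_def)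
qed

lemma firstsD:
  assumes "finite G" "{u, v} \<subseteq> G" "u + 2 \<le> v" "firsts G = (p, q)"
  shows "p \<in> G" "q \<in> G" "p + 2 \<le> q" "\<And>j. j \<in> G \<Longrightarrow> p \<le> j"
    "\<And>j. j \<in> G \<Longrightarrow> p + 2 \<le> j \<Longrightarrow> q \<le> j"
proof -
  have p: "p = Min G" and q: "q = Min {j \<in> G. p + 2 \<le> j}"
    using assms(4) by (auto simp: firsts_def)
  show "p \<in> G" using Min_in[OF assms(1)] assms(2) p by blast
  show le: "p \<le> j" if "j \<in> G" for j using assms(1) that p by simp
  have "v \<in> {j \<in> G. p + 2 \<le> j}" using le[of u] assms(2,3) by auto
  then have "q \<in> {j \<in> G. p + 2 \<le> j}"
    unfolding q using assms(1) by (intro Min_in) auto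
  then show "q \<in> G" "p + 2 \<le> q" by auto
  show "q \<le> j" if "j \<in> G" "p + 2 \<le> j" for j
    unfolding q using assms(1) that by (intro Min_le) auto
qed

text \<open>Fewer available positions can only delay the greedy choice: \<open>p'\<close> competes
  for \<open>p\<close>, and once \<open>p = p'\<close>, \<open>q'\<close> competes for
  \<open>q\<close>.\<close>

lemma firsts_antimono:
  assumes "finite G" "G' \<subseteq> G" "{u, v} \<subseteq> G'" "u + 2 \<le> v"
  shows "firsts G \<le> firsts G'"
proof -
  obtain p q p' q' where e: "firsts G = (p, q)" "firsts G' = (p', q')" by fastforce
  have "{u, v} \<subseteq> G" "finite G'" using assms finite_subset by auto
  note d = firstsD[OF assms(1) this(1) assms(4) e(1)] and d' = firstsD[OF this(2) assms(3,4) e(2)]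
  have "p \<le> p'" using d(4) d'(1) assms(2) by blast
  moreover have "q \<le> q'" if "p = p'" using d(5)[of q'] d'(2,3) assms(2) that by blast
  ultimately show ?thesis unfolding e by (cases "p = p'") (simp_all add: less_eq_prod_def)
qed

definition free :: "nat \<Rightarrow> nat \<Rightarrow> nat set set \<Rightarrow> nat set" where
  "free k r A = {j. j < k + 6 \<and> rot k r j \<notin> \<Union>A}"

lemma finite_free: "finite (free k r A)"
  by (simp add: free_def)

lemma free_antimono: "A \<subseteq> B \<Longrightarrow> free k r B \<subseteq> free k r A"
  by (auto simp: free_def)

text \<open>Here \<open>b\<close> comes from an unstable vertex at positions \<open>0\<close>,
  \<open>1\<close>, \<open>b\<close>. The entry \<open>1\<close> gives way to \<open>0\<close> when
  it would adjoin \<open>b = 2\<close>, and \<open>p + 1\<close> gives way to \<open>q + 1\<close>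
  when it would meet or adjoin \<open>b\<close>; \<open>b = p\<close> cannot occur, as
  \<open>p\<close> is free.\<close>

definition detour :: "nat \<Rightarrow> nat \<Rightarrow> nat \<Rightarrow> nat \<times> nat \<Rightarrow> nat set" where
  "detour k r b = (\<lambda>(p, q). rot k r `
     {if b = 2 then 0 else 1, b, if b = p + 1 \<or> b = p + 2 then q + 1 else p + 1})"

lemma free_has_stable_triple:
  assumes r: "r \<in> {1..k+6}"
    and w: "w \<in> kneser_verts k" "stable k w" "w \<inter> \<Union>A = {}"
  obtains u1 u2 u3 where "{u1, u2, u3} \<subseteq> free k r A" "u1 + 2 \<le> u2" "u2 + 2 \<le> u3"
proof -
  obtain u1 u2 u3 where u: "u1 < u2" "u2 < u3" "u3 < k + 6" "w = rot k r ` {u1, u2, u3}"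
    using kneser_rot_sorted[OF r w(1)] .
  have "u1 + 2 \<le> u2" "u2 + 2 \<le> u3" using stable_rot_triple_iff[OF r u(1-3)] u(4) w(2) by auto
  moreover have "{u1, u2, u3} \<subseteq> free k r A"
    using u w(3) by (auto simp: free_def)
  ultimately show thesis using that by blast
qed

text \<open>The two smallest free positions \<open>p\<close> and \<open>q \<ge> p + 2\<close> extend to a free stable triple.  Whether
  \<open>p + 1\<close> or \<open>q + 1\<close> is free affects neither this nor the choice of \<open>p\<close> and \<open>q\<close>, so a vertex whose
  remaining elements are covered by \<open>{r, r + 1, r + b}\<close> may be toggled.\<close>

lemma detour_toggle:
  assumes r: "r \<in> {1..k+6}" and b: "2 \<le> b" "b < k + 6" and v: "rot k r ` {0, 1, b} \<in> A"
    and w: "w \<in> kneser_verts k" "stable k w" "w \<inter> \<Union>A = {}"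
    and x: "x = detour k r b (firsts (free k r A))"
  shows "x \<in> kneser_verts k" "stable k x"
    and "B - {x} = A - {x} \<Longrightarrow> firsts (free k r B) = firsts (free k r A)"
    and "B - {x} = A - {x} \<Longrightarrow> \<exists>w\<in>kneser_verts k. stable k w \<and> w \<inter> \<Union>B = {}"
proof -
  let ?G = "free k r A"
  obtain u1 u2 u3 where u: "{u1, u2, u3} \<subseteq> ?G" "u1 + 2 \<le> u2" "u2 + 2 \<le> u3"
    using free_has_stable_triple[OF r w] .
  obtain p q where pq: "firsts ?G = (p, q)" by fastforce
  have "{u1, u2} \<subseteq> ?G" using u(1) by auto
  note d = firstsD[OF finite_free this u(2) pq]
  \<comment> \<open>Since \<open>p \<le> u1\<close>, the position \<open>u2\<close> competes for
    \<open>q\<close>; so \<open>q \<le> u2\<close>, and \<open>u3\<close> completes \<open>p\<close>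
    and \<open>q\<close> to a stable triple.\<close>
  have q3: "q + 2 \<le> u3" using d(5)[of u2] d(4)[of u1] u by auto
  have u3: "u3 < k + 6" using u(1) by (auto simp: free_def)
  have v_free: "j \<notin> ?G" if "j \<in> {0, 1, b}" for j
    using v that unfolding free_def by blast
  \<comment> \<open>Positions 0 and 1 are covered by the unstable vertex, so the triple
    \<open>p\<close>, \<open>q\<close>, \<open>u3\<close> avoids the wraparound.\<close>
  have p2: "2 \<le> p" using v_free d(1) by (metis One_nat_def insertCI less_2_cases not_less)
  have bpq: "b \<noteq> p" "b \<noteq> q" "b \<noteq> u3" using v_free[of b] d(1,2) u(1) by auto
  define c where "c = (if b = p + 1 \<or> b = p + 2 then q + 1 else p + 1)"
  define e where "e = (if b = 2 then 0 else (1::nat))"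
  have x': "x = rot k r ` {e, b, c}"
    unfolding x pq detour_def e_def c_def by simp
  \<comment> \<open>Covering \<open>c\<close> leaves \<open>p\<close>, \<open>q\<close> and
    \<open>u3\<close> free. The bound \<open>k + 4\<close> excludes the wraparound pair when
    \<open>x\<close> uses position 0.\<close>
  have c: "3 \<le> c" "c \<le> k + 4" "c + 2 \<le> b \<or> b + 2 \<le> c" "c \<noteq> p" "c \<noteq> q" "c < u3" "b = 2 \<Longrightarrow> 4 \<le> c"
    "c = p + 1 \<or> c = q + 1"
    using p2 d(3) q3 u3 bpq by (auto simp: c_def split: if_splits)
  have e: "e + 2 \<le> b" "e + 2 \<le> c" "e = 0 \<Longrightarrow> b = 2" "e \<le> 1"
    using b c by (auto simp: e_def split: if_splits)
  have "x \<in> kneser_verts k \<and> stable k x"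
  proof (cases "b < c")
    case True
    have o: "e < b" "b < c" "c < k + 6" using True e c by auto
    have "b + 2 \<le> c" using True c(3) by simp
    then show ?thesis
      using rot_triple_kneser[OF r o] stable_rot_triple_iff[OF r o] e c unfolding x' by auto
  next
    case False
    have o: "e < c" "c < b" "b < k + 6" using False e c b by auto
    have "c + 2 \<le> b" using False c(3) b o by simp
    moreover have "x = rot k r ` {e, c, b}" unfolding x' by (simp add: insert_commute)
    ultimately show ?thesis
      using rot_triple_kneser[OF r o] stable_rot_triple_iff[OF r o] e c by auto
  qed
  then show xV: "x \<in> kneser_verts k" and xs: "stable k x" by auto
  have "{0, 1, b} \<subseteq> {..<k+6}" using b by auto
  from stable_rot_iff[OF r this] have vu: "\<not> stable k (rot k r ` {0, 1, b})" by simp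
  have key: "firsts (free k r B) = firsts ?G \<and> (\<exists>w\<in>kneser_verts k. stable k w \<and> w \<inter> \<Union>B = {})"
    if B: "B - {x} = A - {x}"
  proof -
    \<comment> \<open>The positions of \<open>x\<close> other than \<open>c\<close> are among
      \<open>0\<close>, \<open>1\<close>, \<open>b\<close>, already covered by the unstable vertex.
      That vertex differs from the stable \<open>x\<close>, so it is also in
      \<open>B\<close>.\<close>
    have same: "j \<in> free k r B \<longleftrightarrow> j \<in> ?G" if "j \<noteq> c" for j
    proof (cases "j < k + 6 \<and> rot k r j \<in> x")
      case True
      have "{e, b, c} \<subseteq> {..<k+6}" using e b c by auto
      then have "j \<in> {e, b, c}"
        using rot_mem_image_iff[OF r, of "{e, b, c}" j] True x' by auto
      then have "rot k r j \<in> rot k r ` {0, 1, b}" using that e(4) by (auto simp: e_def)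
      moreover have "rot k r ` {0, 1, b} \<in> A" "rot k r ` {0, 1, b} \<in> B"
        using v B vu xs by auto
      ultimately show ?thesis unfolding free_def by blast
    next
      case False
      have "rot k r j \<in> \<Union>B \<longleftrightarrow> rot k r j \<in> \<Union>A" if "rot k r j \<notin> x"
        using that B by blast
      then show ?thesis using False by (auto simp: free_def)
    qed
    have f: "firsts (free k r B) = (p, q)"
    proof (rule firsts_eqI[OF finite_free _ _ d(3)])
      show "p \<in> free k r B" "q \<in> free k r B" using same c d by auto
      \<comment> \<open>Freeing \<open>c\<close> changes neither minimum: \<open>p + 1\<close> is
        above \<open>p\<close> but too close to serve as \<open>q\<close>, and \<open>q + 1\<close>
        is above \<open>q\<close>.\<close>
      show "p \<le> j" if "j \<in> free k r B" for j
        using same[of j] d(3) d(4)[of j] that c(8) by (cases "j = c") auto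
      show "q \<le> j" if "j \<in> free k r B" "p + 2 \<le> j" for j
        using same[of j] d(3) d(5)[of j] that c(8) by (cases "j = c") auto
    qed
    have o: "p < q" "q < u3" "u3 < k + 6" using d(3) q3 u3 by auto
    have "{p, q, u3} \<subseteq> free k r B" using same c d u(1) by auto
    then have "rot k r ` {p, q, u3} \<inter> \<Union>B = {}" by (auto simp: free_def)
    moreover have "stable k (rot k r ` {p, q, u3})"
      using stable_rot_triple_iff[OF r o] d(3) q3 p2 by auto
    ultimately show ?thesis using f pq rot_triple_kneser[OF r o] by auto
  qed
  then show "B - {x} = A - {x} \<Longrightarrow> firsts (free k r B) = firsts ?G"
    "B - {x} = A - {x} \<Longrightarrow> \<exists>w\<in>kneser_verts k. stable k w \<and> w \<inter> \<Union>B = {}"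
    by blast+
qed

text \<open>Let \<open>r\<close> be the first point of a cyclically consecutive pair in
  \<open>v\<close>; the pair then occupies positions 0 and 1.\<close>

lemma unstable_rot:
  assumes "v \<in> kneser_verts k" "\<not> stable k v"
  obtains r b where "r \<in> {1..k+6}" "2 \<le> b" "b < k + 6" "v = rot k r ` {0, 1, b}"
proof -
  obtain r where r: "r \<in> {1..k+6}" "r \<in> v" "r mod (k+6) + 1 \<in> v"
    using assms(2) unfolding stable_def by auto
  obtain a b c where s: "a < b" "b < c" "c < k + 6" "v = rot k r ` {a, b, c}"
    using kneser_rot_sorted[OF r(1) assms(1)] .
  have "rot k r 0 \<in> v" "rot k r 1 \<in> v" using r rot_0 rot_1 by auto
  then have "a = 0" "b = 1" using rot_mem_triple_iff[OF r(1) s(1-3)] s by auto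
  then show thesis using that[of r c] r s by auto
qed

definition unstable_part :: "nat \<Rightarrow> nat set set \<Rightarrow> nat set set" where
  "unstable_part k A = {v \<in> A. \<not> stable k v}"

text \<open>The choice sees only the unstable members, so toggling a stable vertex cannot change
  it.\<close>

definition unstable_code :: "nat \<Rightarrow> nat set set \<Rightarrow> nat \<times> nat" where
  "unstable_code k E = (SOME (r, b). r \<in> {1..k+6} \<and> 2 \<le> b \<and> b < k + 6 \<and> rot k r ` {0, 1, b} \<in> E)"

lemma unstable_codeE:
  assumes "A \<subseteq> kneser_verts k" "unstable_part k A \<noteq> {}"
  obtains r b where "unstable_code k (unstable_part k A) = (r, b)" "r \<in> {1..k+6}" "2 \<le> b" "b < k + 6"
    "rot k r ` {0, 1, b} \<in> A"
proof -
  let ?P = "\<lambda>(r, b). r \<in> {1..k+6} \<and> 2 \<le> b \<and> b < k + 6 \<and> rot k r ` {0, 1, b} \<in> unstable_part k A"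
  obtain v where v: "v \<in> unstable_part k A" using assms(2) by blast
  then have "v \<in> kneser_verts k" "\<not> stable k v" using assms(1) by (auto simp: unstable_part_def)
  then obtain r b where "?P (r, b)" using unstable_rot v by (metis (no_types, lifting) case_prodI)
  then have "?P (unstable_code k (unstable_part k A))"
    unfolding unstable_code_def by (rule someI)
  then show thesis using that by (auto simp: unstable_part_def split: prod.splits)
qed

text \<open>Along an inclusion the number of unstable members cannot drop. If it is unchanged, the
  members themselves and hence \<open>r\<close> and \<open>b\<close> agree, and the shrinking free
  set can only move \<open>firsts\<close> up; equal \<open>firsts\<close> then give equal
  \<open>g\<close>.\<close>

lemma collapse_unstable:
  "collapses_onto (neighborhood_complex (S3 k))
     {A \<in> neighborhood_complex (S3 k). \<forall>a\<in>A. stable k a}" (is "collapses_onto ?X ?Y")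
proof -
  define code where "code A = unstable_code k (unstable_part k A)" for A
  define fp where "fp A = firsts (free k (fst (code A)) A)" for A
  define g where "g A = detour k (fst (code A)) (snd (code A)) (fp A)" for A
  define h where "h A = (card (unstable_part k A), fp A)" for A
  \<comment> \<open>An unstable member forces the common neighbor to be stable, as
    \<open>detour_toggle\<close> requires.\<close>
  have F: "A \<in> ?X - ?Y \<longleftrightarrow> A \<subseteq> kneser_verts k \<and> unstable_part k A \<noteq> {} \<and>
      (\<exists>w\<in>kneser_verts k. stable k w \<and> w \<inter> \<Union>A = {})" for A
    unfolding in_neighborhood_S3_iff mem_Collect_eq Diff_iff unstable_part_def by auto
  have tog: "B \<in> ?X - ?Y \<and> h B = h A"
    if A: "A \<in> ?X - ?Y" and B: "B = insert (g A) A \<or> B = A - {g A}" for A B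
  proof -
    have A': "A \<subseteq> kneser_verts k" "unstable_part k A \<noteq> {}" using A[unfolded F] by blast+
    obtain w where w: "w \<in> kneser_verts k" "stable k w" "w \<inter> \<Union>A = {}" using A[unfolded F] by blast
    obtain r b where c: "code A = (r, b)" and r: "r \<in> {1..k+6}" "2 \<le> b" "b < k + 6" "rot k r ` {0, 1, b} \<in> A"
      using unstable_codeE[OF A'] unfolding code_def .
    have gA: "g A = detour k r b (firsts (free k r A))" by (simp add: g_def fp_def c)
    note t = detour_toggle[OF r w gA]
    have BA: "B - {g A} = A - {g A}" using B by blast
    have up: "unstable_part k B = unstable_part k A"
      using B t(2) by (auto simp: unstable_part_def)
    then have "code B = (r, b)" using c by (simp add: code_def)
    then have "h B = h A" using t(3)[OF BA] up c by (simp add: h_def fp_def)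
    moreover have "B \<subseteq> kneser_verts k" using B t(1) A'(1) by blast
    ultimately show ?thesis unfolding F up using t(4)[OF BA] A'(2) by blast
  qed
  have mono: "h A \<le> h B \<and> (h A = h B \<longrightarrow> g A = g B)"
    if A: "A \<in> ?X - ?Y" and B: "B \<in> ?X - ?Y" and AB: "A \<subseteq> B" for A B
  proof -
    have B': "B \<subseteq> kneser_verts k" "unstable_part k B \<noteq> {}" using B[unfolded F] by blast+
    obtain w where w: "w \<in> kneser_verts k" "stable k w" "w \<inter> \<Union>B = {}" using B[unfolded F] by blast
    have sub: "unstable_part k A \<subseteq> unstable_part k B" using AB by (auto simp: unstable_part_def)
    have fin: "finite (unstable_part k B)"
      by (rule finite_subset[OF _ finite_kneser_verts[of k]]) (use B'(1) in \<open>auto simp: unstable_part_def\<close>)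
    have le: "card (unstable_part k A) \<le> card (unstable_part k B)" using card_mono[OF fin sub] .
    show ?thesis
    proof (cases "card (unstable_part k A) = card (unstable_part k B)")
      case True
      then have e: "code A = code B" using card_subset_eq[OF fin sub] by (simp add: code_def)
      obtain r b where c: "code B = (r, b)" and r: "r \<in> {1..k+6}" "2 \<le> b" "b < k + 6" "rot k r ` {0, 1, b} \<in> B"
        using unstable_codeE[OF B'] unfolding code_def .
      obtain u1 u2 u3 where u: "{u1, u2, u3} \<subseteq> free k r B" "u1 + 2 \<le> u2"
        using free_has_stable_triple[OF r(1) w] .
      then have "{u1, u2} \<subseteq> free k r B" by auto
      then have "fp A \<le> fp B"
        using firsts_antimono[OF finite_free free_antimono[OF AB] _ u(2)] by (simp add: fp_def e c)
      then show ?thesis using True e by (auto simp: h_def g_def less_eq_prod_def)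
    next
      case False
      then show ?thesis using le by (auto simp: h_def less_eq_prod_def)
    qed
  qed
  show ?thesis
  proof (rule collapses_onto_toggle[where g = g and h = h])
    show "finite ?X" by (rule finite_neighborhood_S3)
    show "?Y \<subseteq> ?X" by blast
    show "finite A" if "A \<in> ?X" for A
      using that unfolding neighborhood_complex_def by blast
    show "B \<notin> ?Y" if "A \<in> ?X - ?Y" "B \<in> ?X" "A \<subseteq> B" for A B
      using that by blast
    show "insert (g A) A \<in> ?X - ?Y \<and> h (insert (g A) A) = h A" if "A \<in> ?X - ?Y" for A
      by (rule tog[OF that]) simp
    show "A - {g A} \<in> ?X - ?Y \<and> h (A - {g A}) = h A" if "A \<in> ?X - ?Y" for A
      by (rule tog[OF that]) simp
    show "h A \<le> h B" if "A \<in> ?X - ?Y" "B \<in> ?X - ?Y" "A \<subseteq> B" for A B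
      using mono[OF that] by (rule conjunct1)
    show "g A = g B" if "A \<in> ?X - ?Y" "B \<in> ?X - ?Y" "A \<subseteq> B" "h A = h B" for A B
      using mono[OF that(1-3)] that(4) by (rule conjunct2[THEN mp])
  qed
qed

section \<open>Removing the simplices without a stable common neighbour\<close>

definition triples :: "nat \<Rightarrow> nat \<Rightarrow> nat set set \<Rightarrow> (nat \<times> nat \<times> nat) set" where
  "triples k r A = {(a, b, c). a < b \<and> b < c \<and> c < k + 6 \<and> rot k r ` {a, b, c} \<in> A}"

lemma finite_triples: "finite (triples k r A)"
  by (rule finite_subset[of _ "{..<k+6} \<times> {..<k+6} \<times> {..<k+6}"]) (auto simp: triples_def)

lemma triples_mono: "A \<subseteq> B \<Longrightarrow> triples k r A \<subseteq> triples k r B"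
  by (auto simp: triples_def)

lemma triples_nonempty:
  assumes "r \<in> {1..k+6}" "A \<subseteq> kneser_verts k" "A \<noteq> {}"
  shows "triples k r A \<noteq> {}"
proof -
  obtain v where v: "v \<in> A" using assms(3) by blast
  then obtain a b c where "a < b" "b < c" "c < k + 6" "v = rot k r ` {a, b, c}"
    using kneser_rot_sorted[OF assms(1)] assms(2) by blast
  then have "(a, b, c) \<in> triples k r A" using v by (simp add: triples_def)
  then show ?thesis by blast
qed

text \<open>The fallback \<open>b + 1\<close> need not be covered in general;
  \<open>exchange_toggle\<close> derives it from the absence of a stable common neighbor.\<close>

definition pivot :: "nat \<Rightarrow> nat \<Rightarrow> nat set \<Rightarrow> nat \<times> nat \<times> nat \<Rightarrow> nat" where
  "pivot k r U = (\<lambda>(a, b, c). if rot k r (a + 1) \<in> U then a + 1 else b + 1)"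

text \<open>Candidates for the exchange. The vertex to be toggled will avoid the pivot, so toggling
  it does not affect this set.\<close>

definition companions :: "nat \<Rightarrow> nat \<Rightarrow> nat set set \<Rightarrow> nat \<times> nat \<times> nat \<Rightarrow> nat set" where
  "companions k r A = (\<lambda>(a, b, c). {j. j < k + 6 \<and> j \<notin> {a, b, c} \<and>
     (\<exists>y\<in>A. rot k r (pivot k r (\<Union>A) (a, b, c)) \<in> y \<and> rot k r j \<in> y)})"

lemma finite_companions: "finite (companions k r A x)"
  by (cases x) (simp add: companions_def)

text \<open>Relevant for \<open>i < b\<close> with \<open>i \<noteq> a\<close>, where the
  replacement makes the triple lexicographically smaller.\<close>

definition exchange :: "nat \<Rightarrow> nat \<Rightarrow> nat \<times> nat \<times> nat \<Rightarrow> nat \<Rightarrow> nat set" where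
  "exchange k r = (\<lambda>(a, b, c) i. rot k r ` (if i < a then {i, b, c} else {a, i, c}))"

text \<open>Let \<open>x = (a, b, c)\<close> be the lexicographically largest triple of \<open>A\<close>, counted from an uncovered
  \<open>r\<close>.  One of \<open>a + 1\<close>, \<open>b + 1\<close> is covered, because otherwise these two and \<open>r\<close> would form a stable
  vertex disjoint from all of \<open>A\<close>.  A vertex \<open>y\<close> covering it is lexicographically smaller than \<open>x\<close> and
  so supplies an element that can be exchanged into \<open>x\<close>; the resulting vertex is covered by \<open>x\<close> and
  \<open>y\<close>.\<close>

lemma exchange_toggle:
  assumes r: "r \<in> {1..k+6}" "r \<notin> \<Union>A"
    and A: "A \<noteq> {}" "A \<subseteq> kneser_verts k" "\<forall>a\<in>A. stable k a"
    and no: "\<not> (\<exists>w\<in>kneser_verts k. w \<inter> \<Union>A = {} \<and> stable k w)"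
    and x: "x = Max (triples k r A)"
    and z: "z = exchange k r x (Min (companions k r A x))"
  shows "companions k r A x \<noteq> {}" "z \<in> kneser_verts k" "stable k z"
    and "B = insert z A \<or> B = A - {z} \<Longrightarrow> B \<noteq> {} \<and> \<Union>B = \<Union>A \<and> Max (triples k r B) = x \<and>
      companions k r B x = companions k r A x"
proof -
  let ?T = "triples k r A"
  obtain a b c where abc: "x = (a, b, c)" by (cases x) auto
  have "x \<in> ?T" unfolding x by (rule Max_in[OF finite_triples triples_nonempty[OF r(1) A(2,1)]])
  then have o: "a < b" "b < c" "c < k + 6" and xA: "rot k r ` {a, b, c} \<in> A"
    by (auto simp: triples_def abc)
  have gap: "a + 2 \<le> b" "b + 2 \<le> c"
    using stable_rot_triple_iff[OF r(1) o] A(3) xA by auto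
  \<comment> \<open>Position 0 is the uncovered \<open>r\<close>, so no member of \<open>A\<close>
    meets the wraparound.\<close>
  have pos: "0 < j" if "rot k r j \<in> \<Union>A" for j
    using that r rot_0[OF r(1)] by (cases j) auto
  have a0: "0 < a" by (rule pos) (use xA in auto)
  define d where "d = pivot k r (\<Union>A) x"
  have d': "d = a + 1 \<or> d = b + 1" by (auto simp: d_def abc pivot_def)
  have dU: "rot k r d \<in> \<Union>A"
  proof (rule ccontr)
    assume "rot k r d \<notin> \<Union>A"
    then have n: "rot k r (a + 1) \<notin> \<Union>A" "rot k r (b + 1) \<notin> \<Union>A"
      by (auto simp: d_def abc pivot_def split: if_splits)
    have o': "0 < a + 1" "a + 1 < b + 1" "b + 1 < k + 6" using o by auto
    have "stable k (rot k r ` {0, a + 1, b + 1})"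
      using stable_rot_triple_iff[OF r(1) o'] a0 gap o by auto
    moreover have "rot k r ` {0, a + 1, b + 1} \<inter> \<Union>A = {}"
      using n r rot_0[OF r(1)] by auto
    ultimately show False using no rot_triple_kneser[OF r(1) o'] by blast
  qed
  have lt_d: "d < k + 6" using d' o by auto
  let ?I = "companions k r A x"
  have I: "j \<in> ?I \<longleftrightarrow> j < k + 6 \<and> j \<notin> {a, b, c} \<and> (\<exists>y\<in>A. rot k r d \<in> y \<and> rot k r j \<in> y)" for j
    by (simp add: companions_def abc d_def)
  have inI: "j \<in> ?I" if "j < k + 6" "j \<noteq> a" "j \<noteq> b" "j \<noteq> c" "y \<in> A" "rot k r d \<in> y" "rot k r j \<in> y" for j y
    unfolding I using that by blast
  \<comment> \<open>Maximality of \<open>x\<close> gives \<open>p < a\<close>, or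
    \<open>p = a\<close> and \<open>q \<le> b\<close>. In the second case the gap after
    \<open>p\<close> rules out \<open>d = a + 1\<close>, and \<open>d = b + 1\<close> can only be
    \<open>s\<close>, which forces \<open>q < b\<close>.\<close>
  have dec: "\<exists>p q s. p < q \<and> q < s \<and> s < k + 6 \<and> y = rot k r ` {p, q, s} \<and> p + 2 \<le> q \<and> q + 2 \<le> s \<and>
      (d = p \<or> d = q \<or> d = s) \<and> (p < a \<or> p = a \<and> (d = b + 1 \<and> s = b + 1 \<and> q < b))"
    if y: "y \<in> A" "rot k r d \<in> y" for y
  proof -
    have "y \<in> kneser_verts k" using y A(2) by blast
    then obtain p q s where p: "p < q" "q < s" "s < k + 6" "y = rot k r ` {p, q, s}"
      using kneser_rot_sorted[OF r(1)] by blast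
    have g: "p + 2 \<le> q" "q + 2 \<le> s"
      using stable_rot_triple_iff[OF r(1) p(1-3)] A(3) y p(4) by auto
    have dm: "d = p \<or> d = q \<or> d = s"
      using rot_mem_triple_iff[OF r(1) p(1-3) lt_d] y(2) p(4) by simp
    have "(p, q, s) \<in> ?T" using p y by (simp add: triples_def)
    then have "(p, q, s) \<le> x" unfolding x by (rule Max_ge[OF finite_triples])
    then have "p < a \<or> p = a \<and> q \<le> b" by (auto simp: abc less_eq_prod_def)
    then have "p < a \<or> p = a \<and> (d = b + 1 \<and> s = b + 1 \<and> q < b)"
      using g dm d' gap by linarith
    with p g dm show ?thesis by (intro exI[of _ p] exI[of _ q] exI[of _ s] conjI)
  qed
  obtain y where y: "y \<in> A" "rot k r d \<in> y" using dU by blast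
  obtain p q s where p: "p < q" "q < s" "s < k + 6" "y = rot k r ` {p, q, s}" "p + 2 \<le> q"
    "p < a \<or> p = a \<and> (d = b + 1 \<and> s = b + 1 \<and> q < b)"
    using dec[OF y] by blast
  have "\<exists>j\<in>?I. j < b"
  proof (cases "p < a")
    case True
    have "p \<in> ?I"
    proof (rule inI)
      show "rot k r p \<in> y" unfolding p(4) by simp
    qed (use True p(1-3) o y in \<open>simp_all\<close>)
    then show ?thesis by (rule bexI[rotated]) (use True o in simp)
  next
    case False
    then have q: "q < b" "p = a" using p(6) by auto
    have "q \<in> ?I"
    proof (rule inI)
      show "rot k r q \<in> y" unfolding p(4) by simp
    qed (use q p(1-3) o y in \<open>simp_all\<close>)
    then show ?thesis by (rule bexI[rotated]) (rule q(1))
  qed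
  then show ne: "?I \<noteq> {}" by blast
  define i where "i = Min ?I"
  have iI: "i \<in> ?I" unfolding i_def by (rule Min_in[OF finite_companions ne])
  have i_le: "i \<le> j" if "j \<in> ?I" for j unfolding i_def by (rule Min_le[OF finite_companions that])
  have ib: "i < b" using \<open>\<exists>j\<in>?I. j < b\<close> i_le by fastforce
  have ia: "i \<noteq> a" using iI I by blast
  obtain y' where y': "y' \<in> A" "rot k r d \<in> y'" "rot k r i \<in> y'" using iI I by blast
  have i0: "0 < i" by (rule pos) (use y' in blast)
  \<comment> \<open>If \<open>i\<close> is above \<open>a\<close>, the first entry of
    \<open>y'\<close> is not below \<open>a\<close>, else it would be a smaller companion. So
    \<open>y'\<close> starts at \<open>a\<close>, ends at \<open>d = b + 1\<close>, and has
    \<open>i\<close> in the middle.\<close>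
  have mid: "d = b + 1 \<and> a + 2 \<le> i" if "\<not> i < a"
  proof -
    obtain p q s where p: "p < q" "q < s" "s < k + 6" "y' = rot k r ` {p, q, s}" "p + 2 \<le> q"
      "p < a \<or> p = a \<and> (d = b + 1 \<and> s = b + 1 \<and> q < b)"
      using dec[OF y'(1,2)] by blast
    have "\<not> p < a"
    proof
      assume "p < a"
      have "p \<in> ?I"
      proof (rule inI)
        show "rot k r p \<in> y'" unfolding p(4) by simp
      qed (use \<open>p < a\<close> p(1-3) o y' in \<open>simp_all\<close>)
      then show False using i_le \<open>p < a\<close> that by fastforce
    qed
    moreover have "i = p \<or> i = q \<or> i = s"
      using rot_mem_triple_iff[OF r(1) p(1-3), of i] y'(3) p(4) iI I by blast
    ultimately show ?thesis using p ib ia by auto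
  qed
  have zi: "z = rot k r ` (if i < a then {i, b, c} else {a, i, c})"
    unfolding z i_def[symmetric] by (simp only: abc exchange_def prod.case)
  obtain z1 z2 where zz: "z = rot k r ` {z1, z2, c}" "z1 + 2 \<le> z2" "z2 + 2 \<le> c" "0 < z1"
    "(z1, z2, c) < x" "z1 = i \<and> z2 = b \<or> z1 = a \<and> z2 = i" "d \<noteq> z1" "d \<noteq> z2" "d \<noteq> c"
  proof (cases "i < a")
    case True
    then have "z = rot k r ` {i, b, c}" unfolding zi by simp
    then show ?thesis
      by (rule that) (use True gap i0 d' in \<open>auto simp: abc less_prod_def\<close>)
  next
    case False
    then have "z = rot k r ` {a, i, c}" unfolding zi by simp
    then show ?thesis
      by (rule that) (use False gap a0 mid ib in \<open>auto simp: abc less_prod_def\<close>)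
  qed
  have oz: "z1 < z2" "z2 < c" "c < k + 6" using zz o by auto
  show zV: "z \<in> kneser_verts k" unfolding zz(1) by (rule rot_triple_kneser[OF r(1) oz])
  show zs: "stable k z" unfolding zz(1) using stable_rot_triple_iff[OF r(1) oz] zz by auto
  have dz: "rot k r d \<notin> z"
    unfolding zz(1) using rot_mem_triple_iff[OF r(1) oz lt_d] zz by auto
  have xz: "rot k r ` {a, b, c} \<noteq> z"
    using rot_triple_inject[OF r(1) o oz] zz(1,5) abc by auto
  have y'z: "y' \<noteq> z" using y' dz by blast
  have cov: "z \<subseteq> rot k r ` {a, b, c} \<union> y'" using zz(1,6) y'(3) by auto
  show "B \<noteq> {} \<and> \<Union>B = \<Union>A \<and> Max (triples k r B) = x \<and> companions k r B x = ?I"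
    if B: "B = insert z A \<or> B = A - {z}"
  proof -
    have xB: "rot k r ` {a, b, c} \<in> B" and y'B: "y' \<in> B" using B xA xz y'(1) y'z by auto
    have BA: "B - {z} = A - {z}" using B by blast
    have "\<Union>B \<subseteq> \<Union>A \<union> z" "\<Union>A \<subseteq> \<Union>B \<union> z" using BA by blast+
    moreover have "z \<subseteq> \<Union>A" "z \<subseteq> \<Union>B" using cov xA y'(1) xB y'B by blast+
    ultimately have U: "\<Union>B = \<Union>A" by blast
    have "Max (triples k r B) = x"
    proof (rule Max_eqI[OF finite_triples])
      show "x \<in> triples k r B" using xB o by (simp add: abc triples_def)
      fix t assume t: "t \<in> triples k r B"
      obtain p q s where pqs: "t = (p, q, s)" by (cases t) auto
      have p: "p < q" "q < s" "s < k + 6" "rot k r ` {p, q, s} \<in> B"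
        using t by (auto simp: pqs triples_def)
      show "t \<le> x"
      proof (cases "rot k r ` {p, q, s} = z")
        case True
        then show ?thesis
          using rot_triple_inject[OF r(1) p(1-3) oz] zz(1,5) pqs by simp
      next
        case False
        then have "t \<in> ?T" using p B by (auto simp: pqs triples_def)
        then show ?thesis unfolding x by (rule Max_ge[OF finite_triples])
      qed
    qed
    moreover have "companions k r B x = ?I"
    proof -
      have "(\<exists>y\<in>B. rot k r d \<in> y \<and> rot k r j \<in> y) \<longleftrightarrow> (\<exists>y\<in>A. rot k r d \<in> y \<and> rot k r j \<in> y)" for j
        using B dz by blast
      then show ?thesis unfolding companions_def abc prod.case U d_def[symmetric, unfolded abc] by simp
    qed
    ultimately show ?thesis using U xB by blast
  qed
qed

text \<open>Equal unions fix the pivot, so the larger family only offers more members through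
  it.\<close>

lemma companions_mono:
  assumes "A \<subseteq> B" "\<Union>A = \<Union>B"
  shows "companions k r A x \<subseteq> companions k r B x"
  using assms by (cases x) (auto simp: companions_def)

lemma collapse_unstable_neighbour:
  "collapses_onto {A \<in> neighborhood_complex (S3 k). \<forall>a\<in>A. stable k a} (neighborhood_complex (SG3 k))"
    (is "collapses_onto ?X ?Y")
proof -
  \<comment> \<open>The choice depends on \<open>\<Union>A\<close> alone, so a toggle that keeps the
    union keeps the starting point.\<close>
  define base where "base A = (SOME r. r \<in> {1..k+6} - \<Union>A)" for A :: "nat set set"
  define top where "top A = Max (triples k (base A) A)" for A
  define i where "i A = Min (companions k (base A) A (top A))" for A
  define g where "g A = exchange k (base A) (top A) (i A)" for A
  \<comment> \<open>With union and \<open>top\<close> fixed, a larger \<open>A\<close> has more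
    companions, so \<open>i A\<close> can only drop; the subtraction reverses this. It is injective
    here because \<open>i A < k + 6\<close>.\<close>
  define h where "h A = (card (\<Union>A), top A, k + 6 - i A)" for A
  have X: "A \<in> ?X \<longleftrightarrow> A \<noteq> {} \<and> A \<subseteq> kneser_verts k \<and> (\<forall>a\<in>A. stable k a) \<and>
      (\<exists>w\<in>kneser_verts k. w \<inter> \<Union>A = {})" for A
    unfolding in_neighborhood_S3_iff mem_Collect_eq by blast
  have F: "A \<in> ?X - ?Y \<longleftrightarrow> A \<noteq> {} \<and> A \<subseteq> kneser_verts k \<and> (\<forall>a\<in>A. stable k a) \<and>
      (\<exists>w\<in>kneser_verts k. w \<inter> \<Union>A = {}) \<and> \<not> (\<exists>w\<in>kneser_verts k. w \<inter> \<Union>A = {} \<and> stable k w)" for A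
    unfolding Diff_iff X in_neighborhood_SG3_iff by blast
  have base: "base A \<in> {1..k+6}" "base A \<notin> \<Union>A" if A: "A \<in> ?X - ?Y" for A
  proof -
    obtain w where w: "w \<in> kneser_verts k" "w \<inter> \<Union>A = {}" using A[unfolded F] by blast
    then have "w \<noteq> {}" "w \<subseteq> {1..k+6}" by (auto simp: kneser_verts_def)
    then obtain t where "t \<in> {1..k+6} - \<Union>A" using w(2) by blast
    then have "base A \<in> {1..k+6} - \<Union>A" unfolding base_def by (rule someI)
    then show "base A \<in> {1..k+6}" "base A \<notin> \<Union>A" by blast+
  qed
  have base_cong: "base A = base B" if "\<Union>A = \<Union>B" for A B
    using that by (simp add: base_def)
  have fin: "finite (\<Union>A)" if "A \<in> ?X - ?Y" for A
    by (rule finite_subset[of _ "{1..k+6}"]) (use that[unfolded F] in \<open>auto simp: kneser_verts_def\<close>)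
  have toggle: "companions k (base A) A (top A) \<noteq> {}" "g A \<in> kneser_verts k" "stable k (g A)"
    "B = insert (g A) A \<or> B = A - {g A} \<Longrightarrow> B \<noteq> {} \<and> \<Union>B = \<Union>A \<and> Max (triples k (base A) B) = top A \<and>
      companions k (base A) B (top A) = companions k (base A) A (top A)"
    if A: "A \<in> ?X - ?Y" for A B
  proof -
    have A': "A \<noteq> {}" "A \<subseteq> kneser_verts k" "\<forall>a\<in>A. stable k a"
      "\<not> (\<exists>w\<in>kneser_verts k. w \<inter> \<Union>A = {} \<and> stable k w)" using A[unfolded F] by blast+
    note t = exchange_toggle[OF base[OF A] A' top_def g_def[of A, unfolded i_def]]
    show "companions k (base A) A (top A) \<noteq> {}" by (rule t(1))
    show "g A \<in> kneser_verts k" by (rule t(2))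
    show "stable k (g A)" by (rule t(3))
    show "B \<noteq> {} \<and> \<Union>B = \<Union>A \<and> Max (triples k (base A) B) = top A \<and>
      companions k (base A) B (top A) = companions k (base A) A (top A)"
      if "B = insert (g A) A \<or> B = A - {g A}" by (rule t(4)[OF that])
  qed
  have tog: "B \<in> ?X - ?Y \<and> h B = h A"
    if A: "A \<in> ?X - ?Y" and B: "B = insert (g A) A \<or> B = A - {g A}" for A B
  proof -
    have ne: "B \<noteq> {}" and U: "\<Union>B = \<Union>A" and T: "Max (triples k (base A) B) = top A"
      and C: "companions k (base A) B (top A) = companions k (base A) A (top A)"
      using toggle(4)[OF A B] by blast+
    have b: "base B = base A" by (rule base_cong[OF U])
    have tp: "top B = top A" using T by (simp add: top_def b)
    have "i B = i A" using C by (simp add: i_def b tp)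
    then have "h B = h A" by (simp add: h_def U tp)
    moreover have "B \<subseteq> kneser_verts k \<and> (\<forall>a\<in>B. stable k a)"
      using A[unfolded F] B toggle(2,3)[OF A] by blast
    ultimately show ?thesis using A ne unfolding F U by blast
  qed
  have mono: "h A \<le> h B \<and> (h A = h B \<longrightarrow> g A = g B)"
    if A: "A \<in> ?X - ?Y" and B: "B \<in> ?X - ?Y" and AB: "A \<subseteq> B" for A B
  proof -
    have sub: "\<Union>A \<subseteq> \<Union>B" using AB by blast
    have le: "card (\<Union>A) \<le> card (\<Union>B)" by (rule card_mono[OF fin[OF B] sub])
    show ?thesis
    proof (cases "card (\<Union>A) = card (\<Union>B)")
      case False
      then show ?thesis using le by (simp add: h_def less_eq_prod_def)
    next
      case True
      then have U: "\<Union>A = \<Union>B" by (rule card_subset_eq[OF fin[OF B] sub])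
      have b: "base A = base B" by (rule base_cong[OF U])
      have A': "A \<noteq> {}" "A \<subseteq> kneser_verts k" using A[unfolded F] by blast+
      have tle: "top A \<le> top B"
        unfolding top_def b
        by (rule Max_mono[OF triples_mono[OF AB] triples_nonempty[OF base(1)[OF B] A'(2,1)] finite_triples])
      show ?thesis
      proof (cases "top A = top B")
        case False
        then have "top A < top B" using tle by order
        then show ?thesis using True False by (simp add: h_def)
      next
        case t: True
        have ne: "companions k (base B) A (top B) \<noteq> {}" using toggle(1)[OF A] by (simp add: b t)
        have "i B \<le> i A" unfolding i_def b t
          by (rule Min_antimono[OF companions_mono[OF AB U] ne finite_companions])
        moreover have "i A \<in> companions k (base B) A (top B)"
          unfolding i_def b t by (rule Min_in[OF finite_companions ne])
        then have "i A < k + 6" by (cases "top B") (simp add: companions_def)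
        ultimately have "k + 6 - i A \<le> k + 6 - i B" "k + 6 - i A = k + 6 - i B \<longrightarrow> i A = i B"
          by linarith+
        then show ?thesis using True t b by (cases "i A = i B") (simp_all add: h_def g_def)
      qed
    qed
  qed
  show ?thesis
  proof (rule collapses_onto_toggle[where g = g and h = h])
    show "finite ?X" using finite_neighborhood_S3[of k] by simp
    show "?Y \<subseteq> ?X" unfolding subset_iff X in_neighborhood_SG3_iff by blast
    show "finite A" if "A \<in> ?X" for A
      using that unfolding neighborhood_complex_def by blast
    show "B \<notin> ?Y" if "A \<in> ?X - ?Y" "B \<in> ?X" "A \<subseteq> B" for A B
    proof
      assume "B \<in> ?Y"
      then obtain w where "w \<in> kneser_verts k" "w \<inter> \<Union>B = {}" "stable k w"
        unfolding in_neighborhood_SG3_iff by blast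
      moreover from this that(3) have "w \<inter> \<Union>A = {}" by blast
      ultimately show False using that(1)[unfolded F] by metis
    qed
    show "insert (g A) A \<in> ?X - ?Y \<and> h (insert (g A) A) = h A" if "A \<in> ?X - ?Y" for A
      by (rule tog[OF that]) simp
    show "A - {g A} \<in> ?X - ?Y \<and> h (A - {g A}) = h A" if "A \<in> ?X - ?Y" for A
      by (rule tog[OF that]) simp
    show "h A \<le> h B" if "A \<in> ?X - ?Y" "B \<in> ?X - ?Y" "A \<subseteq> B" for A B
      using mono[OF that] by (rule conjunct1)
    show "g A = g B" if "A \<in> ?X - ?Y" "B \<in> ?X - ?Y" "A \<subseteq> B" "h A = h B" for A B
      using mono[OF that(1-3)] that(4) by (rule conjunct2[THEN mp])
  qed
qed

theorem theorem1p1: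
  fixes k :: nat
  shows "collapses_onto (neighborhood_complex (S3 k)) (neighborhood_complex (SG3 k))"
  using collapse_unstable[of k] collapse_unstable_neighbour[of k]
  unfolding collapses_onto_def by (rule rtranclp_trans)

end
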